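(* Let $\underline R$ be a square ring. An $\underline R$-CP-linear map $f:(M,A)\to(N,B)$ between $\underline R$-CP-modules $(M,A),(N,B)$ induces, in the evident way (on $M/A$ by passage to the quotient and on $A$ by restriction), a morphism of graded $\mathrm{OP}(\underline R)$-algebras $$\mathrm{Gr}(f):\mathrm{Gr}(M,A)\to\mathrm{Gr}(N,B).$$
   Context: A square ring $\underline R=(R_e\xrightarrow{H}R_{ee}\xrightarrow{P}R_e)$ consists of: a set $R_e$ with a group structure $+$ (not necessarily commutative) and an associative unital multiplication satisfying $r(s+t)=rs+rt$ (the law $(r+s)t=rt+st$ is not required); an abelian group $R_{ee}$; a map $R_e\times R_e\times R_{ee}\times R_e\to R_{ee}$, $(r,s,x,t)\mapsto(r,s)\cdot x\cdot t$, additive in each of its four variables and defining commuting actions on $R_{ee}$ of the multiplicative monoids $R_e\times R_e$ (on the left) and $R_e$ (on the right) (write $(r,s)\cdot x$ if $t=1$ and $x\cdot t$ if $r=s=1$); a group homomorphism $T:R_{ee}\to R_{ee}$ with $T^2=\mathrm{Id}$; a map $H:R_e\to R_{ee}$ and a group homomorphism $P:R_{ee}\to R_e$; such that for all $r,s,t\in R_e$, $x,y\in R_{ee}$: $PHP=P+P$; $P((r,r)\cdot x\cdot s)=rP(x)s$; $T=HP-\mathrm{Id}$; $PT=P$; $(P(x),r)\cdot y=(r,P(x))\cdot y=0=y\cdot P(x)$; $H(r+s)=H(r)+H(s)+(s,r)\cdot H(2)$ where $2=1+1$; $H(rs)=(r,r)\cdot H(s)+H(r)\cdot s$; $(r+s)t=rt+st+P((r,s)\cdot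 H(t))$; $T((r,s)\cdot x\cdot t)=(s,r)\cdot T(x)\cdot t$. The quotient $\overline R=R_e/\operatorname{Im}P$ is a ring and $R_{ee}$ is an $\overline R\otimes\overline R\otimes\overline R^{op}$-module. $\mathrm{OP}(\underline R)$ is the operad of abelian groups, nilpotent of class $\le2$, with $\mathrm{OP}(\underline R)_1=\overline R$, $\mathrm{OP}(\underline R)_2=R_{ee}$ (symmetric group action given by $T$), $\mathrm{OP}(\underline R)_k=0$ for $k>2$, and compositions given by the multiplication of $\overline R$ and its actions on $R_{ee}$. Concretely, a graded $\mathrm{OP}(\underline R)$-algebra structure on a graded abelian group $X=(X_1,X_2,0,\ldots)$ consists of right $\overline R$-module structures on $X_1,X_2$ and maps $X_i\times X_j\times R_{ee}\to X_{i+j}$, $(u,v,x)\mapsto[u,v]\cdot x$, additive in each variable, with $[v,u]\cdot x=[u,v]\cdot T(x)$, $([u\cdot r,v\cdot s]\cdot x)\cdot t=[u,v]\cdot((r,s)\cdot x\cdot t)$ for $r,s,t\in\overline R$, and vanishing iterated operations $[[u,v]\cdot x,w]\cdot y=0$; morphisms are degree-preserving additive maps commuting with these operations. A (right) $\underline R$-BHP-module is a group $M$ (written additively, not necessarily commutative) with operations $M\times R_e\to M$, $(m,r)\mapsto m\cdot r$ and $M\times M\times R_{ee}\to M$, $(m,n,x)\mapsto[m,n]\cdot x$ such that: $m\cdot1=m$, $(m\cdot r)\cdot s=m\cdot(rs)$, $m\cdot(r+s)=m\cdot r+m\cdot s$; $(m+n)\cdot r=m\cdot r+n\cdot r+[m,n]\cdot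 H(r)$; $m\cdot P(x)=[m,m]\cdot x$; $[m,n]\cdot T(x)=[n,m]\cdot x$; $[m,n]\cdot x$ is additive in each of $m,n,x$; $([m\cdot r,n\cdot s]\cdot x)\cdot t=[m,n]\cdot((r,s)\cdot x\cdot t)$; $[[m,m']\cdot x,n]\cdot y=0$. An $\underline R$-CP-module is a pair $(M,A)$ where $M$ is an $\underline R$-BHP-module and $A$ is a subgroup of $M$, stable under the action of $R_e$, such that $[m,n]\cdot x=0$ whenever $m\in A$, and $[m,n]\cdot x\in A$ for all $m,n\in M$, $x\in R_{ee}$. A map $f:(M,A)\to(N,B)$ is $\underline R$-CP-linear if $f:M\to N$ is additive, $f(m\cdot r)=f(m)\cdot r$, $f([m,m']\cdot x)=[f(m),f(m')]\cdot x$, and $f(A)\subseteq B$. $\mathrm{Gr}(M,A)=(M/A,A,0,\ldots)$ is a graded $\mathrm{OP}(\underline R)$-algebra via $\overline m\cdot\overline r=\overline{m\cdot r}$, $a\cdot\overline r=a\cdot r$ and $\overline m\otimes\overline{m'}\otimes x\mapsto[m,m']\cdot x\in A$ (all other binary operations being zero). *)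

theory Defs
  imports "HOL-Algebra.QuotRing"
begin

text \<open>
  Conventions.  Every group is a HOL-Algebra group relative to its carrier.  Except for the addition
  of \<open>R\<^sub>e\<close>, group laws that are written additively in the mathematics (on \<open>R\<^sub>e\<^sub>e\<close>, on
  modules, on the homogeneous parts of a graded algebra) are the \<open>\<otimes>\<close>, \<open>\<one>\<close>, \<open>inv\<close> of a
  \<^typ>\<open>'a monoid\<close> record.  A map is additive iff it lies in \<^const>\<open>hom\<close>, which also records that it maps
  carrier to carrier.
\<close>

text \<open>
  The \<open>ring\<close> part of the record carries the addition and multiplication of \<open>R\<^sub>e\<close> (which need
  not be a ring); \<open>tact R r s x t\<close> is \<open>(r,s) \<cdot> x \<cdot> t\<close>.
\<close>

record ('r, 'x) sqring = "'r ring" +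
  ee :: "'x monoid"
  tact :: "'r \<Rightarrow> 'r \<Rightarrow> 'x \<Rightarrow> 'r \<Rightarrow> 'x"
  Tmap :: "'x \<Rightarrow> 'x"
  Hmap :: "'r \<Rightarrow> 'x"
  Pmap :: "'x \<Rightarrow> 'r"

abbreviation lact :: "('r, 'x) sqring \<Rightarrow> 'r \<Rightarrow> 'r \<Rightarrow> 'x \<Rightarrow> 'x"
  where "lact R r s x \<equiv> tact R r s x \<one>\<^bsub>R\<^esub>"

abbreviation ract :: "('r, 'x) sqring \<Rightarrow> 'x \<Rightarrow> 'r \<Rightarrow> 'x"
  where "ract R x t \<equiv> tact R \<one>\<^bsub>R\<^esub> \<one>\<^bsub>R\<^esub> x t"

locale square_ring =
  fixes R :: "('r, 'x) sqring" (structure)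
  assumes add_group: "group (add_monoid R)"
    and mult_monoid: "Group.monoid R"
    and distrib_left: "\<lbrakk>r \<in> carrier R; s \<in> carrier R; t \<in> carrier R\<rbrakk>
          \<Longrightarrow> r \<otimes> (s \<oplus> t) = r \<otimes> s \<oplus> r \<otimes> t"
    and ee_group: "comm_group (ee R)"
    and tact_add1: "\<lbrakk>s \<in> carrier R; x \<in> carrier (ee R); t \<in> carrier R\<rbrakk>
          \<Longrightarrow> (\<lambda>r. tact R r s x t) \<in> hom (add_monoid R) (ee R)"
    and tact_add2: "\<lbrakk>r \<in> carrier R; x \<in> carrier (ee R); t \<in> carrier R\<rbrakk>
          \<Longrightarrow> (\<lambda>s. tact R r s x t) \<in> hom (add_monoid R) (ee R)"
    and tact_add3: "\<lbrakk>r \<in> carrier R; s \<in> carrier R; t \<in> carrier R\<rbrakk>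
          \<Longrightarrow> (\<lambda>x. tact R r s x t) \<in> hom (ee R) (ee R)"
    and tact_add4: "\<lbrakk>r \<in> carrier R; s \<in> carrier R; x \<in> carrier (ee R)\<rbrakk>
          \<Longrightarrow> (\<lambda>t. tact R r s x t) \<in> hom (add_monoid R) (ee R)"
    and tact_one: "x \<in> carrier (ee R) \<Longrightarrow> tact R \<one> \<one> x \<one> = x"
    and lact_mult: "\<lbrakk>r \<in> carrier R; r' \<in> carrier R; s \<in> carrier R; s' \<in> carrier R; x \<in> carrier (ee R)\<rbrakk>
          \<Longrightarrow> lact R (r \<otimes> r') (s \<otimes> s') x = lact R r s (lact R r' s' x)"
    and ract_mult: "\<lbrakk>t \<in> carrier R; t' \<in> carrier R; x \<in> carrier (ee R)\<rbrakk>
          \<Longrightarrow> ract R x (t \<otimes> t') = ract R (ract R x t) t'"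
    and tact_left: "\<lbrakk>r \<in> carrier R; s \<in> carrier R; t \<in> carrier R; x \<in> carrier (ee R)\<rbrakk>
          \<Longrightarrow> tact R r s x t = ract R (lact R r s x) t"
    and tact_right: "\<lbrakk>r \<in> carrier R; s \<in> carrier R; t \<in> carrier R; x \<in> carrier (ee R)\<rbrakk>
          \<Longrightarrow> tact R r s x t = lact R r s (ract R x t)"
    and T_hom: "Tmap R \<in> hom (ee R) (ee R)"
    and T_invol: "x \<in> carrier (ee R) \<Longrightarrow> Tmap R (Tmap R x) = x"
    and H_closed: "Hmap R \<in> carrier R \<rightarrow> carrier (ee R)"
    and P_hom: "Pmap R \<in> hom (ee R) (add_monoid R)"
    and PHP: "x \<in> carrier (ee R) \<Longrightarrow> Pmap R (Hmap R (Pmap R x)) = Pmap R x \<oplus> Pmap R x"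
    and P_tact: "\<lbrakk>r \<in> carrier R; s \<in> carrier R; x \<in> carrier (ee R)\<rbrakk>
          \<Longrightarrow> Pmap R (tact R r r x s) = r \<otimes> Pmap R x \<otimes> s"
    and T_eq: "x \<in> carrier (ee R) \<Longrightarrow> Tmap R x = Hmap R (Pmap R x) \<otimes>\<^bsub>ee R\<^esub> inv\<^bsub>ee R\<^esub> x"
    and P_T: "x \<in> carrier (ee R) \<Longrightarrow> Pmap R (Tmap R x) = Pmap R x"
    and P_act1: "\<lbrakk>x \<in> carrier (ee R); r \<in> carrier R; y \<in> carrier (ee R)\<rbrakk>
          \<Longrightarrow> lact R (Pmap R x) r y = \<one>\<^bsub>ee R\<^esub>"
    and P_act2: "\<lbrakk>x \<in> carrier (ee R); r \<in> carrier R; y \<in> carrier (ee R)\<rbrakk>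
          \<Longrightarrow> lact R r (Pmap R x) y = \<one>\<^bsub>ee R\<^esub>"
    and P_act3: "\<lbrakk>x \<in> carrier (ee R); y \<in> carrier (ee R)\<rbrakk>
          \<Longrightarrow> ract R y (Pmap R x) = \<one>\<^bsub>ee R\<^esub>"
    and H_add: "\<lbrakk>r \<in> carrier R; s \<in> carrier R\<rbrakk>
          \<Longrightarrow> Hmap R (r \<oplus> s)
              = Hmap R r \<otimes>\<^bsub>ee R\<^esub> Hmap R s \<otimes>\<^bsub>ee R\<^esub> lact R s r (Hmap R (\<one> \<oplus> \<one>))"
    and H_mult: "\<lbrakk>r \<in> carrier R; s \<in> carrier R\<rbrakk>
          \<Longrightarrow> Hmap R (r \<otimes> s) = lact R r r (Hmap R s) \<otimes>\<^bsub>ee R\<^esub> ract R (Hmap R r) s"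
    and distrib_right: "\<lbrakk>r \<in> carrier R; s \<in> carrier R; t \<in> carrier R\<rbrakk>
          \<Longrightarrow> (r \<oplus> s) \<otimes> t = r \<otimes> t \<oplus> s \<otimes> t \<oplus> Pmap R (lact R r s (Hmap R t))"
    and T_tact: "\<lbrakk>r \<in> carrier R; s \<in> carrier R; t \<in> carrier R; x \<in> carrier (ee R)\<rbrakk>
          \<Longrightarrow> Tmap R (tact R r s x t) = tact R s r (Tmap R x) t"

text \<open>
  \<open>Rbar R\<close> is \<open>R\<^sub>e / Im P\<close> with the operations of the library's ring quotient.  Operations that are
  induced on cosets are taken by \<^const>\<open>the_elem\<close> of the set of all values on representatives, which is
  a singleton exactly if the operation is well defined.
\<close>

definition Rbar :: "('r, 'x) sqring \<Rightarrow> 'r set ring"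
  where "Rbar R = R Quot (Pmap R ` carrier (ee R))"

definition tact_bar :: "('r, 'x) sqring \<Rightarrow> 'r set \<Rightarrow> 'r set \<Rightarrow> 'x \<Rightarrow> 'r set \<Rightarrow> 'x"
  where "tact_bar R r s x t = the_elem ((\<lambda>(r', s', t'). tact R r' s' x t') ` (r \<times> s \<times> t))"

locale right_module = ring S for S (structure) +
  fixes X :: "('a, 'b) monoid_scheme" and act :: "'a \<Rightarrow> 'c \<Rightarrow> 'a"
  assumes module_group: "comm_group X"
    and act_add_left: "r \<in> carrier S \<Longrightarrow> (\<lambda>u. act u r) \<in> hom X X"
    and act_add_right: "u \<in> carrier X \<Longrightarrow> (\<lambda>r. act u r) \<in> hom (add_monoid S) X"
    and act_one: "u \<in> carrier X \<Longrightarrow> act u \<one> = u"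
    and act_mult: "\<lbrakk>u \<in> carrier X; r \<in> carrier S; s \<in> carrier S\<rbrakk>
          \<Longrightarrow> act (act u r) s = act u (r \<otimes> s)"

text \<open>
  A graded algebra with underlying graded group \<open>X = (X\<^sub>1, X\<^sub>2, 0, \<dots>)\<close>.  Since \<open>X\<^sub>k = 0\<close> for \<open>k > 2\<close>,
  of the operations \<open>X\<^sub>i \<times> X\<^sub>j \<times> R\<^sub>e\<^sub>e \<rightarrow> X\<^sub>i\<^sub>+\<^sub>j\<close> only the one with \<open>i = j = 1\<close> is not forced to be
  zero; it is \<open>br X u v x\<close> \<open>= [u,v] \<cdot> x\<close>.  Iterated operations take values in degrees above 2,
  so their vanishing is part of this shape, and the axioms below hold trivially in the other degrees.
\<close>

record ('a, 'b, 'c, 'x) graded_alg =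
  deg1 :: "'a monoid"
  deg2 :: "'b monoid"
  act1 :: "'a \<Rightarrow> 'c \<Rightarrow> 'a"
  act2 :: "'b \<Rightarrow> 'c \<Rightarrow> 'b"
  br :: "'a \<Rightarrow> 'a \<Rightarrow> 'x \<Rightarrow> 'b"

locale OP_algebra =
  fixes R :: "('r, 'x) sqring" and X :: "('a, 'b, 'r set, 'x) graded_alg"
  assumes square_ring: "square_ring R"
    and module1: "right_module (Rbar R) (deg1 X) (act1 X)"
    and module2: "right_module (Rbar R) (deg2 X) (act2 X)"
    and br_add1: "\<lbrakk>v \<in> carrier (deg1 X); x \<in> carrier (ee R)\<rbrakk>
          \<Longrightarrow> (\<lambda>u. br X u v x) \<in> hom (deg1 X) (deg2 X)"
    and br_add2: "\<lbrakk>u \<in> carrier (deg1 X); x \<in> carrier (ee R)\<rbrakk>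
          \<Longrightarrow> (\<lambda>v. br X u v x) \<in> hom (deg1 X) (deg2 X)"
    and br_add3: "\<lbrakk>u \<in> carrier (deg1 X); v \<in> carrier (deg1 X)\<rbrakk>
          \<Longrightarrow> (\<lambda>x. br X u v x) \<in> hom (ee R) (deg2 X)"
    and br_sym: "\<lbrakk>u \<in> carrier (deg1 X); v \<in> carrier (deg1 X); x \<in> carrier (ee R)\<rbrakk>
          \<Longrightarrow> br X v u x = br X u v (Tmap R x)"
    and br_act: "\<lbrakk>u \<in> carrier (deg1 X); v \<in> carrier (deg1 X); x \<in> carrier (ee R);
            r \<in> carrier (Rbar R); s \<in> carrier (Rbar R); t \<in> carrier (Rbar R)\<rbrakk>
          \<Longrightarrow> act2 X (br X (act1 X u r) (act1 X v s) x) t = br X u v (tact_bar R r s x t)"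

text \<open>A degree-preserving map is the pair of its components in degrees 1 and 2.\<close>

locale OP_morphism =
  X: OP_algebra R X + Y: OP_algebra R Y
  for R :: "('r, 'x) sqring"
    and X :: "('a, 'b, 'r set, 'x) graded_alg"
    and Y :: "('c, 'd, 'r set, 'x) graded_alg" +
  fixes g :: "('a \<Rightarrow> 'c) \<times> ('b \<Rightarrow> 'd)"
  assumes hom1: "fst g \<in> hom (deg1 X) (deg1 Y)"
    and hom2: "snd g \<in> hom (deg2 X) (deg2 Y)"
    and map_act1: "\<lbrakk>u \<in> carrier (deg1 X); r \<in> carrier (Rbar R)\<rbrakk>
          \<Longrightarrow> fst g (act1 X u r) = act1 Y (fst g u) r"
    and map_act2: "\<lbrakk>a \<in> carrier (deg2 X); r \<in> carrier (Rbar R)\<rbrakk>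
          \<Longrightarrow> snd g (act2 X a r) = act2 Y (snd g a) r"
    and map_br: "\<lbrakk>u \<in> carrier (deg1 X); v \<in> carrier (deg1 X); x \<in> carrier (ee R)\<rbrakk>
          \<Longrightarrow> snd g (br X u v x) = br Y (fst g u) (fst g v) x"

text \<open>\<open>mact M m r\<close> is \<open>m \<cdot> r\<close> and \<open>mbr M m n x\<close> is \<open>[m,n] \<cdot> x\<close>.\<close>

record ('m, 'r, 'x) bhp = "'m monoid" +
  mact :: "'m \<Rightarrow> 'r \<Rightarrow> 'm"
  mbr :: "'m \<Rightarrow> 'm \<Rightarrow> 'x \<Rightarrow> 'm"

locale BHP_module = square_ring R + group M
  for R :: "('r, 'x) sqring" and M :: "('m, 'r, 'x) bhp" +
  assumes mact_closed: "\<lbrakk>m \<in> carrier M; r \<in> carrier R\<rbrakk> \<Longrightarrow> mact M m r \<in> carrier M"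
    and mact_one: "m \<in> carrier M \<Longrightarrow> mact M m \<one>\<^bsub>R\<^esub> = m"
    and mact_mult: "\<lbrakk>m \<in> carrier M; r \<in> carrier R; s \<in> carrier R\<rbrakk>
          \<Longrightarrow> mact M (mact M m r) s = mact M m (r \<otimes>\<^bsub>R\<^esub> s)"
    and mact_add_right: "\<lbrakk>m \<in> carrier M; r \<in> carrier R; s \<in> carrier R\<rbrakk>
          \<Longrightarrow> mact M m (r \<oplus>\<^bsub>R\<^esub> s) = mact M m r \<otimes>\<^bsub>M\<^esub> mact M m s"
    and mact_add_left: "\<lbrakk>m \<in> carrier M; n \<in> carrier M; r \<in> carrier R\<rbrakk>
          \<Longrightarrow> mact M (m \<otimes>\<^bsub>M\<^esub> n) r
              = mact M m r \<otimes>\<^bsub>M\<^esub> mact M n r \<otimes>\<^bsub>M\<^esub> mbr M m n (Hmap R r)"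
    and mact_P: "\<lbrakk>m \<in> carrier M; x \<in> carrier (ee R)\<rbrakk>
          \<Longrightarrow> mact M m (Pmap R x) = mbr M m m x"
    and mbr_T: "\<lbrakk>m \<in> carrier M; n \<in> carrier M; x \<in> carrier (ee R)\<rbrakk>
          \<Longrightarrow> mbr M m n (Tmap R x) = mbr M n m x"
    and mbr_add1: "\<lbrakk>n \<in> carrier M; x \<in> carrier (ee R)\<rbrakk> \<Longrightarrow> (\<lambda>m. mbr M m n x) \<in> hom M M"
    and mbr_add2: "\<lbrakk>m \<in> carrier M; x \<in> carrier (ee R)\<rbrakk> \<Longrightarrow> (\<lambda>n. mbr M m n x) \<in> hom M M"
    and mbr_add3: "\<lbrakk>m \<in> carrier M; n \<in> carrier M\<rbrakk> \<Longrightarrow> (\<lambda>x. mbr M m n x) \<in> hom (ee R) M"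
    and mbr_act: "\<lbrakk>m \<in> carrier M; n \<in> carrier M; x \<in> carrier (ee R);
            r \<in> carrier R; s \<in> carrier R; t \<in> carrier R\<rbrakk>
          \<Longrightarrow> mact M (mbr M (mact M m r) (mact M n s) x) t = mbr M m n (tact R r s x t)"
    and mbr_iter: "\<lbrakk>m \<in> carrier M; m' \<in> carrier M; n \<in> carrier M;
            x \<in> carrier (ee R); y \<in> carrier (ee R)\<rbrakk>
          \<Longrightarrow> mbr M (mbr M m m' x) n y = \<one>\<^bsub>M\<^esub>"

locale CP_module = BHP_module R M + subgroup A M
  for R :: "('r, 'x) sqring" and M :: "('m, 'r, 'x) bhp" and A :: "'m set" +
  assumes A_stable: "\<lbrakk>a \<in> A; r \<in> carrier R\<rbrakk> \<Longrightarrow> mact M a r \<in> A"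
    and A_br: "\<lbrakk>a \<in> A; n \<in> carrier M; x \<in> carrier (ee R)\<rbrakk> \<Longrightarrow> mbr M a n x = \<one>\<^bsub>M\<^esub>"
    and br_in_A: "\<lbrakk>m \<in> carrier M; n \<in> carrier M; x \<in> carrier (ee R)\<rbrakk> \<Longrightarrow> mbr M m n x \<in> A"

locale CP_linear =
  dom: CP_module R M A + cod: CP_module R N B
  for R :: "('r, 'x) sqring"
    and M :: "('m, 'r, 'x) bhp" and A :: "'m set"
    and N :: "('n, 'r, 'x) bhp" and B :: "'n set" +
  fixes f :: "'m \<Rightarrow> 'n"
  assumes f_hom: "f \<in> hom M N"
    and f_act: "\<lbrakk>m \<in> carrier M; r \<in> carrier R\<rbrakk> \<Longrightarrow> f (mact M m r) = mact N (f m) r"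
    and f_br: "\<lbrakk>m \<in> carrier M; m' \<in> carrier M; x \<in> carrier (ee R)\<rbrakk>
          \<Longrightarrow> f (mbr M m m' x) = mbr N (f m) (f m') x"
    and f_sub: "f ` A \<subseteq> B"

definition Gr :: "('m, 'r, 'x) bhp \<Rightarrow> 'm set \<Rightarrow> ('m set, 'm, 'r set, 'x) graded_alg"
  where "Gr M A =
    \<lparr> deg1 = M Mod A,
      deg2 = \<lparr>carrier = A, mult = mult M, one = \<one>\<^bsub>M\<^esub>\<rparr>,
      act1 = (\<lambda>u r. the_elem ((\<lambda>(m, r'). A #>\<^bsub>M\<^esub> mact M m r') ` (u \<times> r))),
      act2 = (\<lambda>a r. the_elem ((\<lambda>r'. mact M a r') ` r)),
      br = (\<lambda>u v x. the_elem ((\<lambda>(m, n). mbr M m n x) ` (u \<times> v))) \<rparr>"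

definition Gr_map ::
  "('m, 'r, 'x) bhp \<Rightarrow> 'm set \<Rightarrow> ('n, 'r, 'x) bhp \<Rightarrow> 'n set \<Rightarrow> ('m \<Rightarrow> 'n)
    \<Rightarrow> ('m set \<Rightarrow> 'n set) \<times> ('m \<Rightarrow> 'n)"
  where "Gr_map M A N B f =
    ((\<lambda>u. the_elem ((\<lambda>m. B #>\<^bsub>N\<^esub> f m) ` u)), restrict f A)"

end

theory Submission
  imports Defs
begin

text \<open>
  Expanding \<open>(m + n) \<cdot> 2\<close> by either additivity rule shows that \<open>n + m + n\<close> and \<open>m + n + n\<close> differ
  by \<open>[m,n] \<cdot> H(2)\<close>.  This vanishes if \<open>m \<in> A\<close> and always lies in \<open>A\<close>, so \<open>A\<close> is central and
  \<open>M/A\<close> is abelian.  The same argument in \<open>R\<^sub>e\<close>, with \<open>P((r,s) \<cdot> H(2))\<close> in place of the bracket, shows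
  that \<open>Im P\<close> is central and \<open>R\<^sub>e/Im P\<close> is abelian under addition.  Every operation therefore descends to
  cosets, and the algebra and morphism laws can be checked on representatives.
\<close>

section \<open>Values that do not depend on the representative, and quotients of groups\<close>

lemma the_elem_image_const:
  assumes "x \<in> S" "\<And>y. y \<in> S \<Longrightarrow> g y = c"
  shows "the_elem (g ` S) = c"
proof -
  have "g ` S = {c}" using assms by auto
  thus ?thesis by simp
qed

lemma (in group) central_imp_normal:
  assumes "subgroup H G"
    and "\<And>h x. \<lbrakk>h \<in> H; x \<in> carrier G\<rbrakk> \<Longrightarrow> x \<otimes> h = h \<otimes> x"
  shows "H \<lhd> G"
  using assms(1)
proof (rule normalI, intro ballI)
  fix x assume "x \<in> carrier G"
  hence "h \<otimes> x = x \<otimes> h" if "h \<in> H" for h using assms(2) that by metis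
  thus "H #> x = x <# H" unfolding r_coset_def l_coset_def by simp
qed

text \<open>The hypothesis has the shape that expanding a double in two ways produces. Modulo
  \<open>H\<close> it reads \<open>y \<otimes> x \<otimes> y = x \<otimes> y \<otimes> y\<close>,
  and cancelling the last \<open>y\<close> makes the quotient commutative.\<close>

lemma (in normal) comm_group_FactGroup:
  assumes "\<And>x y. \<lbrakk>x \<in> carrier G; y \<in> carrier G\<rbrakk> \<Longrightarrow> \<exists>c\<in>H. y \<otimes> x \<otimes> y = x \<otimes> y \<otimes> y \<otimes> c"
  shows "comm_group (G Mod H)"
proof -
  interpret Q: group "G Mod H" by (rule factorgroup_is_group)
  have comm: "(H #> x) \<otimes>\<^bsub>G Mod H\<^esub> (H #> y) = (H #> y) \<otimes>\<^bsub>G Mod H\<^esub> (H #> x)"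
    if x: "x \<in> carrier G" and y: "y \<in> carrier G" for x y
  proof -
    have X: "H #> x \<in> carrier (G Mod H)" "H #> y \<in> carrier (G Mod H)"
      using x y by (auto simp: FactGroup_def RCOSETS_def)
    obtain c where c: "c \<in> H" "y \<otimes> x \<otimes> y = x \<otimes> y \<otimes> y \<otimes> c"
      using assms[OF x y] by blast
    have "H #> (y \<otimes> x \<otimes> y) = (H #> (x \<otimes> y \<otimes> y)) <#> (H #> c)"
      using c x y by (simp add: rcos_sum)
    \<comment> \<open>Since \<open>c\<close> lies in \<open>H\<close>, its coset is
      \<open>H\<close>, which is also the coset of \<open>\<one>\<close>; the instance of
      \<open>rcos_sum\<close> at \<open>\<one>\<close> absorbs it.\<close>
    also have "\<dots> = H #> (x \<otimes> y \<otimes> y)"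
      using c x y rcos_sum[of "x \<otimes> y \<otimes> y" \<one>] by (simp add: rcos_const subset coset_mult_one)
    finally have "(H #> y) \<otimes>\<^bsub>G Mod H\<^esub> (H #> x) \<otimes>\<^bsub>G Mod H\<^esub> (H #> y)
        = (H #> x) \<otimes>\<^bsub>G Mod H\<^esub> (H #> y) \<otimes>\<^bsub>G Mod H\<^esub> (H #> y)"
      using x y by (simp add: FactGroup_def rcos_sum)
    thus ?thesis using X by (metis Q.m_closed Q.right_cancel)
  qed
  show ?thesis
    by (rule Q.group_comm_groupI) (use comm in \<open>auto simp: FactGroup_def RCOSETS_def\<close>)
qed

section \<open>The ring \<open>Rbar R\<close> and its action on \<open>ee R\<close>\<close>

context square_ring
begin

abbreviation ImP :: "'r set"
  where "ImP \<equiv> Pmap R ` carrier (ee R)"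

interpretation add: group "add_monoid R"
  rewrites "carrier (add_monoid R) = carrier R"
    and "monoid.mult (add_monoid R) = add R"
    and "monoid.one (add_monoid R) = zero R"
  by (rule add_group) simp_all

interpretation mul: Group.monoid R
  by (rule mult_monoid)

interpretation E: comm_group "ee R"
  by (rule ee_group)

interpretation P: group_hom "ee R" "add_monoid R" "Pmap R"
  by (intro group_hom.intro group_hom_axioms.intro P_hom add_group E.group_axioms)

lemma P_closed: "x \<in> carrier (ee R) \<Longrightarrow> Pmap R x \<in> carrier R"
  using P.hom_closed by simp

lemma tact_closed:
  "\<lbrakk>r \<in> carrier R; s \<in> carrier R; x \<in> carrier (ee R); t \<in> carrier R\<rbrakk>
    \<Longrightarrow> tact R r s x t \<in> carrier (ee R)"
  using tact_add3 by (auto simp: hom_def)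

lemma T_closed: "x \<in> carrier (ee R) \<Longrightarrow> Tmap R x \<in> carrier (ee R)"
  using T_hom by (auto simp: hom_def)

lemma Hmap_closed: "r \<in> carrier R \<Longrightarrow> Hmap R r \<in> carrier (ee R)"
  using H_closed by auto

text \<open>The interpretations above end with this context, so these closure facts are kept under
  the locale for the module contexts.\<close>

lemmas add_closed = add.m_closed
lemmas mult_closed = mul.m_closed
lemmas mul_one_closed = mul.one_closed
lemmas ee_mult_closed = E.m_closed

lemma two_closed: "\<one> \<oplus> \<one> \<in> carrier R"
  by simp

lemma tact_zero:
  "\<lbrakk>r \<in> carrier R; s \<in> carrier R; t \<in> carrier R\<rbrakk> \<Longrightarrow> tact R r s \<one>\<^bsub>ee R\<^esub> t = \<one>\<^bsub>ee R\<^esub>"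
  using group_hom.hom_one[of "ee R" "ee R" "\<lambda>x. tact R r s x t"] tact_add3
  by (simp add: group_hom_def group_hom_axioms_def)

text \<open>\<open>(r \<oplus> s) \<otimes> (\<one> \<oplus> \<one>)\<close> is expanded by the left
  law and by the right law with its correction term; then the leading \<open>r\<close> is cancelled.
  The order of summands matters throughout.\<close>

lemma double_add:
  assumes "r \<in> carrier R" "s \<in> carrier R"
  shows "s \<oplus> r \<oplus> s = r \<oplus> s \<oplus> s \<oplus> Pmap R (lact R r s (Hmap R (\<one> \<oplus> \<one>)))"
proof -
  let ?p = "Pmap R (lact R r s (Hmap R (\<one> \<oplus> \<one>)))"
  have p: "?p \<in> carrier R"
    using assms by (intro P_closed tact_closed Hmap_closed) auto
  have "(r \<oplus> s) \<oplus> (r \<oplus> s) = (r \<oplus> s) \<otimes> (\<one> \<oplus> \<one>)"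
    using assms by (simp add: distrib_left)
  also have "\<dots> = (r \<oplus> r) \<oplus> (s \<oplus> s) \<oplus> ?p"
    using assms by (subst distrib_right) (simp_all add: distrib_left)
  finally have "r \<oplus> (s \<oplus> r \<oplus> s) = r \<oplus> (r \<oplus> s \<oplus> s \<oplus> ?p)"
    using assms p by (simp add: add.m_assoc)
  thus ?thesis using assms p by (simp add: add.m_assoc)
qed

lemma P_central:
  assumes "x \<in> carrier (ee R)" "r \<in> carrier R"
  shows "r \<oplus> Pmap R x = Pmap R x \<oplus> r"
proof -
  \<comment> \<open>By \<open>P_act1\<close> the correction term is \<open>P\<close> of the neutral
    element, hence zero; cancelling \<open>r\<close> on the right then gives the claim.\<close>
  have "r \<oplus> Pmap R x \<oplus> r = Pmap R x \<oplus> r \<oplus> r \<oplus> Pmap R (\<one>\<^bsub>ee R\<^esub>)"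
    using double_add[of "Pmap R x" r] assms by (simp add: P_closed P_act1 Hmap_closed)
  thus ?thesis using assms P.hom_one by (simp add: P_closed)
qed

lemma ImP_normal: "ImP \<lhd> add_monoid R"
  by (rule group.central_imp_normal[OF add_group])
     (use P.img_is_subgroup P_central in auto)

interpretation I: normal ImP "add_monoid R"
  by (rule ImP_normal)

lemma carrier_Rbar: "carrier (Rbar R) = (\<lambda>r. ImP +> r) ` carrier R"
  by (auto simp: Rbar_def FactRing_def A_RCOSETS_def RCOSETS_def a_r_coset_def)

text \<open>Makes the results on group quotients applicable to the addition of
  \<open>Rbar R\<close>.\<close>

lemma add_monoid_Rbar: "add_monoid (Rbar R) = add_monoid R Mod ImP"
  by (simp add: Rbar_def FactRing_def FactGroup_def A_RCOSETS_def set_add_def)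

lemma mem_coset: "r' \<in> ImP +> r \<longleftrightarrow> (\<exists>x\<in>carrier (ee R). r' = Pmap R x \<oplus> r)"
  by (auto simp: a_r_coset_def r_coset_def)

lemma coset_self: "r \<in> carrier R \<Longrightarrow> r \<in> ImP +> r"
  using P.hom_one by (auto simp: mem_coset intro!: bexI[of _ "\<one>\<^bsub>ee R\<^esub>"])

lemma coset_P_add:
  assumes "x \<in> carrier (ee R)" "r \<in> carrier R"
  shows "ImP +> (Pmap R x \<oplus> r) = ImP +> r"
  using add.repr_independence[of "Pmap R x \<oplus> r" "ImP" r] assms I.subgroup_axioms
  by (auto simp: mem_coset[unfolded a_r_coset_def] a_r_coset_def)

lemma coset_add_P:
  assumes "x \<in> carrier (ee R)" "r \<in> carrier R"
  shows "ImP +> (r \<oplus> Pmap R x) = ImP +> r"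
  using assms by (simp add: P_central coset_P_add)

lemma Rbar_add:
  assumes "r \<in> carrier R" "s \<in> carrier R"
  shows "(ImP +> r) \<oplus>\<^bsub>Rbar R\<^esub> (ImP +> s) = ImP +> (r \<oplus> s)"
  using I.rcos_sum[of r s] assms
  by (simp add: Rbar_def FactRing_def set_add_def a_r_coset_def)

text \<open>By \<open>P_tact\<close> the image of \<open>P\<close> absorbs products from both sides,
  as an ideal would. The correction term of \<open>distrib_right\<close> vanishes because
  \<open>P_act1\<close> kills its first argument.\<close>

lemma coset_mult:
  assumes "r \<in> carrier R" "s \<in> carrier R" "r' \<in> ImP +> r" "s' \<in> ImP +> s"
  shows "ImP +> (r' \<otimes> s') = ImP +> (r \<otimes> s)"
proof -
  obtain x y where x: "x \<in> carrier (ee R)" "r' = Pmap R x \<oplus> r"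
    and y: "y \<in> carrier (ee R)" "s' = Pmap R y \<oplus> s"
    using assms by (auto simp: mem_coset)
  have s': "s' \<in> carrier R" using y assms by (simp add: P_closed)
  have 1: "r' \<otimes> s' = Pmap R (ract R x s') \<oplus> r \<otimes> s'"
    using x assms s' P.hom_one P_tact[of \<one> s' x]
    by (simp add: distrib_right P_closed P_act1 Hmap_closed)
  have 2: "r \<otimes> s' = Pmap R (lact R r r y) \<oplus> r \<otimes> s"
    using y assms P_tact[of r \<one> y] by (simp add: distrib_left P_closed)
  show ?thesis
    unfolding 1 unfolding 2 using x y assms s'
    by (simp add: coset_P_add tact_closed P_closed)
qed

text \<open>The product in the quotient is a union of cosets over all representatives. By
  \<open>coset_mult\<close> these cosets coincide, and the union collapses because the index sets
  are nonempty.\<close>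

lemma Rbar_mult:
  assumes "r \<in> carrier R" "s \<in> carrier R"
  shows "(ImP +> r) \<otimes>\<^bsub>Rbar R\<^esub> (ImP +> s) = ImP +> (r \<otimes> s)"
proof -
  have "(ImP +> r) \<otimes>\<^bsub>Rbar R\<^esub> (ImP +> s) = (\<Union>r'\<in>ImP +> r. \<Union>s'\<in>ImP +> s. ImP +> (r' \<otimes> s'))"
    by (simp add: Rbar_def FactRing_def rcoset_mult_def)
  also have "\<dots> = (\<Union>r'\<in>ImP +> r. \<Union>s'\<in>ImP +> s. ImP +> (r \<otimes> s))"
    using coset_mult assms by (intro SUP_cong) auto
  also have "\<dots> = ImP +> (r \<otimes> s)"
    using coset_self[OF assms(1)] coset_self[OF assms(2)] by auto
  finally show ?thesis .
qed

lemma Rbar_one: "\<one>\<^bsub>Rbar R\<^esub> = ImP +> \<one>"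
  by (simp add: Rbar_def FactRing_def)

text \<open>As \<open>R\<close> itself need not be a ring, the laws are checked on representatives.
  Commutativity of addition comes from \<open>double_add\<close>, and right distributivity holds
  because its correction term lies in \<open>ImP\<close>.\<close>

lemma ring_Rbar: "ring (Rbar R)"
proof -
  have "\<exists>c\<in>ImP. s \<oplus> r \<oplus> s = r \<oplus> s \<oplus> s \<oplus> c" if "r \<in> carrier R" "s \<in> carrier R" for r s
    using double_add[of r s] that by (auto intro!: tact_closed Hmap_closed)
  hence "comm_group (add_monoid (Rbar R))"
    unfolding add_monoid_Rbar by (intro I.comm_group_FactGroup) simp
  hence "abelian_group (Rbar R)"
    by (simp add: abelian_group_def abelian_group_axioms_def abelian_monoid_def comm_group_def)
  moreover have "Group.monoid (Rbar R)"
    by (rule monoidI) (auto simp: carrier_Rbar Rbar_mult Rbar_one mul.m_assoc)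
  moreover have "ring_axioms (Rbar R)"
    by unfold_locales
       (auto simp: carrier_Rbar Rbar_mult Rbar_add distrib_left distrib_right coset_add_P
         tact_closed Hmap_closed P_closed)
  ultimately show ?thesis by (simp add: ring_def)
qed

text \<open>The three arguments are changed one at a time: additivity splits off a term with an
  argument in \<open>ImP\<close>, and that term vanishes.\<close>

lemma tact_coset:
  assumes "r \<in> carrier R" "s \<in> carrier R" "t \<in> carrier R" "x \<in> carrier (ee R)"
    and "r' \<in> ImP +> r" "s' \<in> ImP +> s" "t' \<in> ImP +> t"
  shows "tact R r' s' x t' = tact R r s x t"
proof -
  obtain a b c where a: "a \<in> carrier (ee R)" "r' = Pmap R a \<oplus> r"
    and b: "b \<in> carrier (ee R)" "s' = Pmap R b \<oplus> s"
    and c: "c \<in> carrier (ee R)" "t' = Pmap R c \<oplus> t"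
    using assms by (auto simp: mem_coset)
  note cl = assms P_closed[OF a(1)] P_closed[OF b(1)] P_closed[OF c(1)]
  have s': "s' \<in> carrier R" and t': "t' \<in> carrier R"
    using b c cl by auto
  \<comment> \<open>\<open>P_act1\<close> concerns the left action alone, so
    \<open>tact_left\<close> first separates the right factor, which fixes the neutral
    element.\<close>
  have "tact R (Pmap R a) s' x t' = \<one>\<^bsub>ee R\<^esub>"
    using tact_left[of "Pmap R a" s' t' x] a cl s' t' by (simp add: P_act1 tact_zero)
  hence 1: "tact R r' s' x t' = tact R r s' x t'"
    using hom_mult[OF tact_add1[of s' x t'], of "Pmap R a" r] a cl s' t'
    by (simp add: tact_closed)
  have "tact R r (Pmap R b) x t' = \<one>\<^bsub>ee R\<^esub>"
    using tact_left[of r "Pmap R b" t' x] b cl t' by (simp add: P_act2 tact_zero)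
  hence 2: "tact R r s' x t' = tact R r s x t'"
    using hom_mult[OF tact_add2[of r x t'], of "Pmap R b" s] b cl t'
    by (simp add: tact_closed)
  \<comment> \<open>\<open>P_act3\<close> concerns the right action alone, so here
    \<open>tact_right\<close> makes it the inner one.\<close>
  have "tact R r s x (Pmap R c) = \<one>\<^bsub>ee R\<^esub>"
    using tact_right[of r s "Pmap R c" x] c cl by (simp add: P_act3 tact_zero)
  hence 3: "tact R r s x t' = tact R r s x t"
    using hom_mult[OF tact_add4[of r s x], of "Pmap R c" t] c cl
    by (simp add: tact_closed)
  show ?thesis using 1 2 3 by simp
qed

lemma tact_bar_coset:
  assumes "r \<in> carrier R" "s \<in> carrier R" "t \<in> carrier R" "x \<in> carrier (ee R)"
  shows "tact_bar R (ImP +> r) (ImP +> s) x (ImP +> t) = tact R r s x t"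
  unfolding tact_bar_def
  by (rule the_elem_image_const[of "(r, s, t)"])
     (use assms in \<open>auto intro: tact_coset coset_self\<close>)

end

section \<open>Centrality of \<open>A\<close> and operations on cosets of \<open>A\<close>\<close>

context CP_module
begin

lemma mbr_closed:
  "\<lbrakk>m \<in> carrier M; n \<in> carrier M; x \<in> carrier (ee R)\<rbrakk> \<Longrightarrow> mbr M m n x \<in> carrier M"
  using br_in_A subset by blast

text \<open>\<open>mbr_T\<close> swaps the two slots at the cost of applying \<open>T\<close>, which
  reduces this to \<open>A_br\<close>.\<close>

lemma A_br_right:
  "\<lbrakk>m \<in> carrier M; a \<in> A; x \<in> carrier (ee R)\<rbrakk> \<Longrightarrow> mbr M m a x = \<one>\<^bsub>M\<^esub>"
  using mbr_T[of a m x] A_br[of a m "Tmap R x"] T_closed by auto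

text \<open>The counterpart of \<open>double_add\<close>, with \<open>mact_add_right\<close> and
  \<open>mact_add_left\<close> as the two expansions. It serves both the centrality of
  \<open>A\<close> and the commutativity of \<open>M Mod A\<close>.\<close>

lemma double_mult:
  assumes "m \<in> carrier M" "n \<in> carrier M"
  shows "n \<otimes>\<^bsub>M\<^esub> m \<otimes>\<^bsub>M\<^esub> n
    = m \<otimes>\<^bsub>M\<^esub> n \<otimes>\<^bsub>M\<^esub> n \<otimes>\<^bsub>M\<^esub> mbr M m n (Hmap R (\<one>\<^bsub>R\<^esub> \<oplus>\<^bsub>R\<^esub> \<one>\<^bsub>R\<^esub>))"
proof -
  let ?two = "\<one>\<^bsub>R\<^esub> \<oplus>\<^bsub>R\<^esub> \<one>\<^bsub>R\<^esub>"
  let ?p = "mbr M m n (Hmap R ?two)"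
  have p: "?p \<in> carrier M" using assms two_closed by (intro mbr_closed Hmap_closed)
  have "(m \<otimes>\<^bsub>M\<^esub> n) \<otimes>\<^bsub>M\<^esub> (m \<otimes>\<^bsub>M\<^esub> n) = mact M (m \<otimes>\<^bsub>M\<^esub> n) ?two"
    using assms by (simp add: mact_add_right mact_one mul_one_closed)
  also have "\<dots> = (m \<otimes>\<^bsub>M\<^esub> m) \<otimes>\<^bsub>M\<^esub> (n \<otimes>\<^bsub>M\<^esub> n) \<otimes>\<^bsub>M\<^esub> ?p"
    using assms
    by (subst mact_add_left) (simp_all add: mact_add_right mact_one mul_one_closed two_closed)
  finally have "m \<otimes>\<^bsub>M\<^esub> (n \<otimes>\<^bsub>M\<^esub> m \<otimes>\<^bsub>M\<^esub> n) = m \<otimes>\<^bsub>M\<^esub> (m \<otimes>\<^bsub>M\<^esub> n \<otimes>\<^bsub>M\<^esub> n \<otimes>\<^bsub>M\<^esub> ?p)"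
    using assms p by (simp add: m_assoc)
  thus ?thesis using assms p by (simp add: m_assoc)
qed

lemma A_central:
  assumes "a \<in> A" "m \<in> carrier M"
  shows "m \<otimes>\<^bsub>M\<^esub> a = a \<otimes>\<^bsub>M\<^esub> m"
  using double_mult[of a m] assms two_closed by (simp add: A_br Hmap_closed)

lemma A_normal: "A \<lhd> M"
  by (rule central_imp_normal) (use subgroup_axioms A_central in auto)

interpretation A: normal A M
  by (rule A_normal)

lemma mem_A_coset: "m' \<in> A #>\<^bsub>M\<^esub> m \<longleftrightarrow> (\<exists>a\<in>A. m' = a \<otimes>\<^bsub>M\<^esub> m)"
  by (auto simp: r_coset_def)

lemma A_coset_self: "m \<in> carrier M \<Longrightarrow> m \<in> A #>\<^bsub>M\<^esub> m"
  by (auto simp: mem_A_coset intro!: bexI[of _ "\<one>\<^bsub>M\<^esub>"])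

lemma A_coset_mult:
  assumes "a \<in> A" "m \<in> carrier M"
  shows "A #>\<^bsub>M\<^esub> (a \<otimes>\<^bsub>M\<^esub> m) = A #>\<^bsub>M\<^esub> m" "A #>\<^bsub>M\<^esub> (m \<otimes>\<^bsub>M\<^esub> a) = A #>\<^bsub>M\<^esub> m"
  using repr_independence[of "a \<otimes>\<^bsub>M\<^esub> m" A m] assms subgroup_axioms
  by (auto simp: mem_A_coset A_central)

text \<open>Changing \<open>r\<close> by \<open>P(x)\<close> contributes the bracket
  \<open>[m',m'] \<cdot> x\<close>, which lies in \<open>A\<close>. Changing \<open>m\<close> by
  \<open>a\<close> contributes \<open>a \<cdot> r\<close>, again in \<open>A\<close>, while the
  correction bracket vanishes by \<open>A_br\<close>.\<close>

lemma mact_coset: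
  assumes "m \<in> carrier M" "r \<in> carrier R" "m' \<in> A #>\<^bsub>M\<^esub> m" "r' \<in> ImP +>\<^bsub>R\<^esub> r"
  shows "A #>\<^bsub>M\<^esub> mact M m' r' = A #>\<^bsub>M\<^esub> mact M m r"
proof -
  obtain a x where a: "a \<in> A" "m' = a \<otimes>\<^bsub>M\<^esub> m"
    and x: "x \<in> carrier (ee R)" "r' = Pmap R x \<oplus>\<^bsub>R\<^esub> r"
    using assms by (auto simp: mem_A_coset mem_coset)
  have m': "m' \<in> carrier M" using a assms by auto
  have "mact M m' r' = mbr M m' m' x \<otimes>\<^bsub>M\<^esub> mact M m' r"
    using x m' assms by (simp add: mact_add_right P_closed mact_P)
  moreover have "mact M m' r = mact M a r \<otimes>\<^bsub>M\<^esub> mact M m r"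
    using a assms by (simp add: mact_add_left A_br Hmap_closed mact_closed)
  ultimately show ?thesis
    using a x m' assms by (simp add: A_coset_mult br_in_A A_stable mact_closed)
qed

text \<open>Degree 2 is \<open>A\<close> itself, so equality must hold exactly; it does because
  \<open>a \<cdot> P(x) = [a,a] \<cdot> x\<close> is trivial.\<close>

lemma mact_A_coset:
  assumes "a \<in> A" "r \<in> carrier R" "r' \<in> ImP +>\<^bsub>R\<^esub> r"
  shows "mact M a r' = mact M a r"
  using assms by (auto simp: mem_coset mact_add_right P_closed mact_P A_br mact_closed)

lemma mbr_coset:
  assumes "m \<in> carrier M" "n \<in> carrier M" "x \<in> carrier (ee R)"
    and "m' \<in> A #>\<^bsub>M\<^esub> m" "n' \<in> A #>\<^bsub>M\<^esub> n"
  shows "mbr M m' n' x = mbr M m n x"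
proof -
  obtain a b where a: "a \<in> A" "m' = a \<otimes>\<^bsub>M\<^esub> m" and b: "b \<in> A" "n' = b \<otimes>\<^bsub>M\<^esub> n"
    using assms by (auto simp: mem_A_coset)
  have n': "n' \<in> carrier M" using b assms by auto
  have "mbr M m' n' x = mbr M m n' x"
    using a n' assms hom_mult[OF mbr_add1[of n' x], of a m]
    by (simp add: A_br mbr_closed)
  also have "\<dots> = mbr M m n x"
    using b assms hom_mult[OF mbr_add2[of m x], of b n]
    by (simp add: A_br_right mbr_closed)
  finally show ?thesis .
qed

section \<open>The graded algebra \<open>Gr M A\<close>\<close>

lemma Gr_deg1:
  "carrier (deg1 (Gr M A)) = (\<lambda>m. A #>\<^bsub>M\<^esub> m) ` carrier M"
  "\<lbrakk>m \<in> carrier M; n \<in> carrier M\<rbrakk>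
    \<Longrightarrow> (A #>\<^bsub>M\<^esub> m) \<otimes>\<^bsub>deg1 (Gr M A)\<^esub> (A #>\<^bsub>M\<^esub> n) = A #>\<^bsub>M\<^esub> (m \<otimes>\<^bsub>M\<^esub> n)"
  by (auto simp: Gr_def FactGroup_def RCOSETS_def A.rcos_sum)

lemma Gr_deg2:
  "carrier (deg2 (Gr M A)) = A"
  "a \<otimes>\<^bsub>deg2 (Gr M A)\<^esub> b = a \<otimes>\<^bsub>M\<^esub> b"
  by (simp_all add: Gr_def)

lemma Gr_act1:
  assumes "m \<in> carrier M" "r \<in> carrier R"
  shows "act1 (Gr M A) (A #>\<^bsub>M\<^esub> m) (ImP +>\<^bsub>R\<^esub> r) = A #>\<^bsub>M\<^esub> mact M m r"
  unfolding Gr_def graded_alg.simps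
proof (rule the_elem_image_const)
  show "(m, r) \<in> (A #>\<^bsub>M\<^esub> m) \<times> (ImP +>\<^bsub>R\<^esub> r)"
    using assms by (simp add: A_coset_self coset_self)
qed (clarify, rule mact_coset[OF assms])

lemma Gr_act2:
  assumes "a \<in> A" "r \<in> carrier R"
  shows "act2 (Gr M A) a (ImP +>\<^bsub>R\<^esub> r) = mact M a r"
  unfolding Gr_def graded_alg.simps
  by (rule the_elem_image_const[of r])
     (use assms in \<open>auto intro: mact_A_coset coset_self\<close>)

lemma Gr_br:
  assumes "m \<in> carrier M" "n \<in> carrier M" "x \<in> carrier (ee R)"
  shows "br (Gr M A) (A #>\<^bsub>M\<^esub> m) (A #>\<^bsub>M\<^esub> n) x = mbr M m n x"
  unfolding Gr_def graded_alg.simps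
  by (rule the_elem_image_const[of "(m, n)"])
     (use assms in \<open>auto intro: mbr_coset A_coset_self\<close>)

text \<open>The correction bracket in \<open>mact_add_left\<close> lies in \<open>A\<close>, so the
  action becomes additive in the module variable after passing to cosets.\<close>

lemma Gr_module1: "right_module (Rbar R) (deg1 (Gr M A)) (act1 (Gr M A))"
proof (intro right_module.intro right_module_axioms.intro ring_Rbar)
  have "\<exists>c\<in>A. n \<otimes>\<^bsub>M\<^esub> m \<otimes>\<^bsub>M\<^esub> n = m \<otimes>\<^bsub>M\<^esub> n \<otimes>\<^bsub>M\<^esub> n \<otimes>\<^bsub>M\<^esub> c"
    if "m \<in> carrier M" "n \<in> carrier M" for m n
    using double_mult[OF that] that by (blast intro: br_in_A Hmap_closed two_closed)
  thus "comm_group (deg1 (Gr M A))"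
    using A.comm_group_FactGroup by (simp add: Gr_def)
qed (auto simp: hom_def carrier_Rbar Gr_deg1 Gr_act1 mact_closed mact_add_left mact_add_right
    mact_one mact_mult A_coset_mult br_in_A Hmap_closed Rbar_add Rbar_one Rbar_mult
    add_closed mult_closed mul_one_closed)

text \<open>On \<open>A\<close> the correction bracket is trivial by \<open>A_br\<close>, and
  commutativity is the centrality of \<open>A\<close>.\<close>

lemma Gr_module2: "right_module (Rbar R) (deg2 (Gr M A)) (act2 (Gr M A))"
proof (intro right_module.intro right_module_axioms.intro ring_Rbar)
  have "group (deg2 (Gr M A))"
    by (rule groupI) (auto simp: Gr_def m_assoc intro!: bexI[of _ "inv\<^bsub>M\<^esub> _"])
  thus "comm_group (deg2 (Gr M A))"
    by (rule group.group_comm_groupI) (simp add: Gr_deg2 A_central)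
qed (auto simp: hom_def carrier_Rbar Gr_deg2 Gr_act2 A_stable mact_add_left mact_add_right
    mact_one mact_mult A_br Hmap_closed Rbar_add Rbar_one Rbar_mult
    add_closed mult_closed mul_one_closed)

text \<open>On representatives, \<open>tact_bar_coset\<close> turns the induced action back into
  \<open>tact\<close>, so that the compatibility law becomes \<open>mbr_act\<close>.\<close>

lemma Gr_OP_algebra: "OP_algebra R (Gr M A)"
  by (intro OP_algebra.intro square_ring_axioms Gr_module1 Gr_module2)
     (use mbr_add1 mbr_add2 mbr_add3 in \<open>auto simp: hom_def carrier_Rbar Gr_deg1 Gr_deg2
       Gr_act1 Gr_act2 Gr_br br_in_A mbr_T mbr_act tact_bar_coset mact_closed T_closed
       ee_mult_closed tact_closed\<close>)

end

section \<open>The induced morphism\<close>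

context CP_linear
begin

text \<open>Replacing \<open>m\<close> by \<open>a \<otimes> m\<close> multiplies \<open>f m\<close>
  by \<open>f a\<close>, which lies in \<open>B\<close> by \<open>f_sub\<close>, so the coset is
  unchanged.\<close>

lemma Gr_map_coset:
  assumes "m \<in> carrier M"
  shows "fst (Gr_map M A N B f) (A #>\<^bsub>M\<^esub> m) = B #>\<^bsub>N\<^esub> f m"
proof -
  have "B #>\<^bsub>N\<^esub> f m' = B #>\<^bsub>N\<^esub> f m" if "m' \<in> A #>\<^bsub>M\<^esub> m" for m'
    using that assms f_hom f_sub
    by (auto simp: dom.mem_A_coset hom_def cod.A_coset_mult image_subset_iff Pi_iff)
  thus ?thesis
    unfolding Gr_map_def fst_conv using dom.A_coset_self[OF assms]
    by (intro the_elem_image_const)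
qed

lemma Gr_map_A: "a \<in> A \<Longrightarrow> snd (Gr_map M A N B f) a = f a"
  by (simp add: Gr_map_def)

lemma Gr_map_OP_morphism: "OP_morphism R (Gr M A) (Gr N B) (Gr_map M A N B f)"
proof -
  have f_closed: "f m \<in> carrier N" if "m \<in> carrier M" for m
    using f_hom that by (auto simp: hom_def)
  have f_mult: "f (m \<otimes>\<^bsub>M\<^esub> n) = f m \<otimes>\<^bsub>N\<^esub> f n" if "m \<in> carrier M" "n \<in> carrier M" for m n
    using f_hom that by (auto simp: hom_def)
  have f_A: "f a \<in> B" if "a \<in> A" for a using f_sub that by auto
  \<comment> \<open>The second component is \<open>f\<close> restricted to \<open>A\<close>;
    \<open>dom.A_stable\<close> and \<open>dom.br_in_A\<close> place the values of the action and
    the bracket in \<open>A\<close>, so that \<open>Gr_map_A\<close> applies to them.\<close>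
  show ?thesis
    by (intro OP_morphism.intro OP_morphism_axioms.intro dom.Gr_OP_algebra cod.Gr_OP_algebra)
      (auto simp: hom_def dom.carrier_Rbar dom.Gr_deg1 cod.Gr_deg1 dom.Gr_deg2 cod.Gr_deg2
        dom.Gr_act1 cod.Gr_act1 dom.Gr_act2 cod.Gr_act2 dom.Gr_br cod.Gr_br
        Gr_map_coset Gr_map_A f_closed f_mult f_A f_act f_br dom.mact_closed dom.A_stable dom.br_in_A)
qed

end

theorem proposition2p3p5:
  fixes R :: "('r, 'x) sqring"
    and M :: "('m, 'r, 'x) bhp" and A :: "'m set"
    and N :: "('n, 'r, 'x) bhp" and B :: "'n set"
    and f :: "'m \<Rightarrow> 'n"
  assumes "square_ring R"
    and "CP_module R M A"
    and "CP_module R N B"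
    and "CP_linear R M A N B f"
  shows "OP_morphism R (Gr M A) (Gr N B) (Gr_map M A N B f)
    \<and> (\<forall>m\<in>carrier M. fst (Gr_map M A N B f) (A #>\<^bsub>M\<^esub> m) = B #>\<^bsub>N\<^esub> f m)
    \<and> (\<forall>a\<in>A. snd (Gr_map M A N B f) a = f a)"
  using CP_linear.Gr_map_OP_morphism[OF assms(4)] CP_linear.Gr_map_coset[OF assms(4)]
    CP_linear.Gr_map_A[OF assms(4)]
  by blast

end
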